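(* Let $n\ge 1$ and let $H:\mathbb{R}^n\times\mathbb{R}^n\to\mathbb{R}$ be a (possibly discontinuous) function satisfying: (i) $C:=\{(x,p)\in\mathbb{R}^n\times\mathbb{R}^n : H(x,p)\le 0\}$ is closed; (ii) for all $x\in\mathbb{R}^n$ the set $C_x:=\{p\in\mathbb{R}^n : H(x,p)\le 0\}$ is convex; (iii) $C_x=\overline{\{p\in\mathbb{R}^n : (x,p)\in C^\circ\}}$ for all $x\in\mathbb{R}^n$; (iv) there exist constants $0<\alpha_*\le\alpha^*$ such that $B_{1/\alpha^*}(0)\subset C_x\subset B_{1/\alpha_*}(0)$ for all $x\in\mathbb{R}^n$. Let $K\subset\mathbb{R}^n$ be nonempty, compact and connected, and let $u$ be the unique nonnegative viscosity solution of $$H(x,\nabla u)=0\ \text{ in }\mathbb{R}^n\setminus K,\qquad u=0\ \text{ on }K$$ (given by the representation formula recalled in the context). For $t>0$ set $U_t:=\{x\in\mathbb{R}^n : u(x)<t\}$. Then $U_t$ is a John domain for every $t>0$. Moreover, if $K$ is a John domain with respect to a point $x_0\in K^\circ$ with John constant $\kappa_0\in(0,1]$, then for every $t>0$ the set $U_t$ is a John domain with respect to $x_0$ with John constant $$\kappa:=\frac{\alpha_*}{2\alpha^*+\alpha_*}\,\kappa_0 .$$ For every $t>\dfrac{2\,\sup\{r>0 : B_r(x_0)\subset K\}}{\alpha_*\kappa_0}$ one can choose $\kappa=\dfrac{\alpha_*}{2\alpha^*+\alpha_*}$, that is, $U_t$ is a John domain with respect to $x_0$ with John constant $\alpha_*/(2\alpha^*+\alpha_*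 )$.
   Context: Notation: $B_r(y)=\{w\in\mathbb{R}^n : |w-y|<r\}$; $\overline{E}$ and $E^\circ$ denote closure and interior of a set $E$ (the interior $C^\circ$ is taken in $\mathbb{R}^n\times\mathbb{R}^n$); $d(x,E)=\inf_{y\in E}|x-y|$. John domain: a nonempty bounded set $U\subset\mathbb{R}^n$ is a John domain with respect to a fixed point $x_0\in U$ with John constant $\kappa\in(0,1]$ if for every $x\in U$ there is an arc-length parametrized curve $\rho:[0,L_\rho]\to U$ with $\rho(0)=x$, $\rho(L_\rho)=x_0$ and $d(\rho(s),\partial U)\ge\kappa s$ for all $s\in[0,L_\rho]$. "John domain" without further specification means that such $x_0$ and $\kappa$ exist. The same definition (with curves taking values in $K$) is used for the compact set $K$. Viscosity solution: $u\in C(\mathbb{R}^n)$ is a viscosity solution of the problem if $u=0$ on $K$ and, for all $x\in\mathbb{R}^n\setminus K$ and all $\varphi\in C^1(\mathbb{R}^n)$: if $\varphi(x)-u(x)=\min(\varphi-u)$ then $H(x,\nabla\varphi(x))\le 0$; and if $\varphi(x)-u(x)=\max(\varphi-u)$ then $H(x,\nabla\varphi(x))\ge 0$. Standing fact (taken from the literature): under (i)–(iv) and for nonempty compact $K$, the unique nonnegative viscosity solution $u$ is characterized by $$u(x)=\min\Big\{\int_0^{L_\rho}\sigma(\rho(s),\dot\rho(s))\,ds : L_\rho\ge 0,\ \rho\in W^{1,\infty}(0,L_\rho;\mathbb{R}^n),\ |\dot\rho|=1\text{ a.e.},\ \rho(0)=x,\ \rho(L_\rho)\in K\Big\},$$ where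 $\sigma(x,v):=\sup\{-p\cdot v : p\in C_x\}$, and the minimum is attained. Throughout, "the unique nonnegative viscosity solution" means this function $u$. *)

theory Defs
  imports "HOL-Analysis.Analysis"
begin

text \<open>
  The elements of $W^{1,\infty}(0,L;\mathbb{R}^n)$ with $|\dot\rho| = 1$ almost everywhere; an
  arc-length parametrized curve on $[0,L]$ is understood in the same sense.  Sobolev functions on
  the interval are identified with their continuous representatives, that is, with the Lipschitz
  functions, whose weak derivative is the pointwise derivative existing almost everywhere.
  Values of \<open>\<rho>\<close> outside \<open>{0..L}\<close> only affect the derivative at the two endpoints, a null set.
\<close>

definition unit_speed_curve :: "real \<Rightarrow> (real \<Rightarrow> 'a::euclidean_space) \<Rightarrow> bool" where
  "unit_speed_curve L \<rho> \<longleftrightarrow>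
     0 \<le> L \<and>
     (\<exists>B. B-lipschitz_on {0..L} \<rho>) \<and>
     (AE s in lebesgue_on {0..L}.
        \<rho> differentiable (at s) \<and> norm (vector_derivative \<rho> (at s)) = 1)"

text \<open>
  The set \<open>U\<close> need not be open, so that the definition also applies to compact sets.  The
  frontier of a nonempty bounded set is nonempty, hence the library convention for
  \<open>infdist x {}\<close> plays no role.
\<close>

definition john_domain_wrt :: "'a::euclidean_space set \<Rightarrow> 'a \<Rightarrow> real \<Rightarrow> bool" where
  "john_domain_wrt U x0 \<kappa> \<longleftrightarrow>
     U \<noteq> {} \<and> bounded U \<and> x0 \<in> U \<and> 0 < \<kappa> \<and> \<kappa> \<le> 1 \<and>
     (\<forall>x\<in>U. \<exists>L \<rho>. unit_speed_curve L \<rho> \<and> \<rho> ` {0..L} \<subseteq> U \<and> \<rho> 0 = x \<and> \<rho> L = x0 \<and>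
        (\<forall>s\<in>{0..L}. infdist (\<rho> s) (frontier U) \<ge> \<kappa> * s))"

definition john_domain :: "'a::euclidean_space set \<Rightarrow> bool" where
  "john_domain U \<longleftrightarrow> (\<exists>x0 \<kappa>. john_domain_wrt U x0 \<kappa>)"

definition sublevel :: "('a \<Rightarrow> 'a \<Rightarrow> real) \<Rightarrow> ('a \<times> 'a) set" where
  "sublevel H = {(x, p). H x p \<le> 0}"

definition sublevel_at :: "('a \<Rightarrow> 'a \<Rightarrow> real) \<Rightarrow> 'a \<Rightarrow> 'a set" where
  "sublevel_at H x = {p. H x p \<le> 0}"

definition support_fun :: "('a \<Rightarrow> 'a \<Rightarrow> real) \<Rightarrow> 'a \<Rightarrow> 'a::euclidean_space \<Rightarrow> real" where
  "support_fun H x v = (SUP p\<in>sublevel_at H x. - (p \<bullet> v))"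

definition curve_cost ::
    "('a \<Rightarrow> 'a \<Rightarrow> real) \<Rightarrow> real \<Rightarrow> (real \<Rightarrow> 'a::euclidean_space) \<Rightarrow> real" where
  "curve_cost H L \<rho> =
     (LINT s:{0..L}|lebesgue. support_fun H (\<rho> s) (vector_derivative \<rho> (at s)))"

text \<open>
  The nonnegative viscosity solution of $H(x,\nabla u) = 0$ outside \<open>K\<close>, $u = 0$ on \<open>K\<close>, defined
  by its representation formula.  The infimum is a minimum under the standing assumptions on
  \<open>H\<close> and \<open>K\<close>, so \<open>Inf\<close> denotes the minimum of the formula without attainment being assumed.
\<close>

definition hj_solution ::
    "('a \<Rightarrow> 'a \<Rightarrow> real) \<Rightarrow> 'a set \<Rightarrow> 'a::euclidean_space \<Rightarrow> real" where
  "hj_solution H K x =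
     Inf {curve_cost H L \<rho> | L \<rho>. unit_speed_curve L \<rho> \<and> \<rho> 0 = x \<and> \<rho> L \<in> K}"

end

theory Submission
  imports Defs
begin

text \<open>
  Write \<open>u\<close> for the solution and \<open>U\<close> for its sublevel set at height \<open>t\<close>.  By ellipticity a curve of
  length \<open>L\<close> costs between \<open>L / \<alpha>_hi\<close> and \<open>L / \<alpha>_lo\<close>.  The upper bound, applied to segments, makes
  \<open>u\<close> Lipschitz with constant \<open>1 / \<alpha>_lo\<close> (\<open>hj_solution_lipschitz\<close>).  The lower bound gives a descent:
  a point of \<open>U\<close> is the start of a curve into \<open>K\<close> of length less than \<open>\<alpha>_hi * t\<close>, along which \<open>u\<close>
  is below \<open>t - s / \<alpha>_hi\<close> after length \<open>s\<close> (\<open>reachable_descent\<close>).  Together, the ball of radius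
  \<open>\<alpha>_lo / \<alpha>_hi * s\<close> around the point at parameter \<open>s\<close> stays in \<open>U\<close>, which is the John condition
  on the way to \<open>K\<close>.

  It remains to continue from \<open>K\<close> to the centre \<open>x0\<close>.  At that stage at most the length \<open>\<alpha>_hi * t\<close>
  has been used up, and it is enough to keep the distance \<open>\<kappa> * (\<alpha>_hi * t + s)\<close> from the boundary
  after a further length \<open>s\<close> (\<open>john_domain_wrt_reachableI\<close>).  The decisive fact is that \<open>U\<close> contains
  every point closer than \<open>\<alpha>_lo * t\<close> to \<open>K\<close>, and \<open>ball y (r + \<alpha>_lo * t)\<close> whenever
  \<open>ball y r \<subseteq> K\<close> (\<open>ball_add_subset_reachable\<close>).

  If \<open>K\<close> is merely connected, its points are joined to a fixed \<open>x0 \<in> K\<close> by polygons of uniformly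
  bounded length within distance \<open>\<alpha>_lo * t / 2\<close> of \<open>K\<close>; their distance to the boundary of \<open>U\<close> is
  bounded below, so that some small \<open>\<kappa>\<close> works.  If \<open>K\<close> is a John domain with constant \<open>\<kappa>0\<close>, its own
  curves are used, which keep the distance \<open>\<alpha>_lo * t + \<kappa>0 * s\<close>.  This dominates
  \<open>\<kappa> * (\<alpha>_hi * t + s)\<close> for \<open>\<kappa> \<le> \<alpha>_lo / \<alpha>_hi\<close> and \<open>\<kappa> \<le> \<kappa>0\<close>.  For large \<open>t\<close> the term \<open>\<alpha>_lo * t\<close>
  is large enough by itself: the John condition at the end point bounds the lengths of the curves in
  \<open>K\<close> by the inradius at \<open>x0\<close> divided by \<open>\<kappa>0\<close>, hence by \<open>\<alpha>_lo * t / 2\<close>, and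
  \<open>\<kappa> = \<alpha>_lo / (2 * \<alpha>_hi + \<alpha>_lo)\<close> satisfies \<open>\<kappa> * (\<alpha>_hi * t + \<alpha>_lo * t / 2) \<le> \<alpha>_lo * t\<close>.
\<close>

section \<open>Calculus of unit speed curves\<close>

text \<open>
  The form in which the definition is used: the exceptional set becomes one negligible set, and
  the end points, where the values outside the parameter interval would matter, are left out.
\<close>

lemma unit_speed_curve_iff:
  fixes \<rho> :: "real \<Rightarrow> 'a::euclidean_space"
  shows "unit_speed_curve L \<rho> \<longleftrightarrow>
    0 \<le> L \<and> (\<exists>B. B-lipschitz_on {0..L} \<rho>) \<and>
    (\<exists>N. negligible N \<and>
      (\<forall>s\<in>{0<..<L} - N. \<exists>v. (\<rho> has_vector_derivative v) (at s) \<and> norm v = 1))"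
proof -
  let ?P = "\<lambda>s. \<rho> differentiable (at s) \<and> norm (vector_derivative \<rho> (at s)) = 1"
  have P: "?P s \<longleftrightarrow> (\<exists>v. (\<rho> has_vector_derivative v) (at s) \<and> norm v = 1)" for s
    using vector_derivative_works[of \<rho> "at s"] vector_derivative_at[of \<rho> _ s]
    by (auto intro: differentiableI_vector)
  have "(AE s in lebesgue_on {0..L}. ?P s) \<longleftrightarrow> (AE s in lebesgue. s \<in> {0..L} \<longrightarrow> ?P s)"
    by (rule AE_restrict_space_iff) simp
  also have "\<dots> \<longleftrightarrow> (\<exists>N. negligible N \<and> (\<forall>s\<in>{0<..<L} - N. ?P s))" (is "?l \<longleftrightarrow> ?r")
  proof
    assume ?l
    then obtain N where "N \<in> null_sets lebesgue" and
      N: "{s \<in> space lebesgue. \<not> (s \<in> {0..L} \<longrightarrow> ?P s)} \<subseteq> N"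
      unfolding eventually_ae_filter by blast
    then have "negligible N" by (simp add: negligible_iff_null_sets)
    moreover have "?P s" if "s \<in> {0<..<L} - N" for s
      using subsetD[OF N, of s] that by auto
    ultimately show ?r by blast
  next
    assume ?r
    then obtain N where N: "negligible N" "\<forall>s\<in>{0<..<L} - N. ?P s" by blast
    have "negligible (insert 0 (insert L N))"
      using N(1) by simp
    then show ?l
      by (intro AE_I'[of "insert 0 (insert L N)"])
        (use N in \<open>auto simp: negligible_iff_null_sets\<close>)
  qed
  finally show ?thesis
    unfolding unit_speed_curve_def P by blast
qed

lemma has_vector_derivative_cong_interval:
  assumes "(\<rho> has_vector_derivative v) (at s)" "s \<in> {a<..<b}" "\<And>r. r \<in> {a<..<b} \<Longrightarrow> \<rho> r = \<gamma> r"
  shows "(\<gamma> has_vector_derivative v) (at s)"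
  using assms(1) open_greaterThanLessThan assms(2,3)
  by (rule has_vector_derivative_transform_within_open)

lemma vector_derivative_cong_interval:
  assumes "s \<in> {a<..<b}" "\<And>r. r \<in> {a<..<b} \<Longrightarrow> \<rho> r = \<gamma> r"
  shows "vector_derivative \<rho> (at s) = vector_derivative \<gamma> (at s)"
proof -
  have "(\<rho> has_vector_derivative v) (at s) \<longleftrightarrow> (\<gamma> has_vector_derivative v) (at s)" for v
    using has_vector_derivative_cong_interval[OF _ assms(1)] assms(2) by metis
  then show ?thesis by (simp add: vector_derivative_def)
qed

lemma has_vector_derivative_imp_quotient_limit:
  assumes "(f has_vector_derivative v) (at s)"
  shows "((\<lambda>h. (f (s + h) - f s) /\<^sub>R h) \<longlongrightarrow> v) (at 0)"
proof -
  have "((\<lambda>h. norm (f (s + h) - f s - h *\<^sub>R v) / norm h) \<longlongrightarrow> 0) (at 0)"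
    using assms by (simp add: has_vector_derivative_def has_derivative_at)
  moreover have "norm (f (s + h) - f s - h *\<^sub>R v) / norm h = norm ((f (s + h) - f s) /\<^sub>R h - v)"
    if "h \<noteq> 0" for h
  proof -
    have "(f (s + h) - f s) /\<^sub>R h - v = (f (s + h) - f s - h *\<^sub>R v) /\<^sub>R h"
      using that by (simp add: scaleR_right_diff_distrib)
    then show ?thesis by (simp add: divide_inverse_commute)
  qed
  then have "\<forall>\<^sub>F h in at 0. norm (f (s + h) - f s - h *\<^sub>R v) / norm h
      = norm ((f (s + h) - f s) /\<^sub>R h - v)"
    by (simp add: eventually_at_filter)
  ultimately have "((\<lambda>h. norm ((f (s + h) - f s) /\<^sub>R h - v)) \<longlongrightarrow> 0) (at 0)"
    by (rule Lim_transform_eventually)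
  then show ?thesis
    by (rule LIM_zero_cancel[OF tendsto_norm_zero_cancel])
qed

lemma unit_speed_curve_cong:
  assumes "unit_speed_curve L \<rho>" and eq: "\<And>s. s \<in> {0..L} \<Longrightarrow> \<rho> s = \<gamma> s"
  shows "unit_speed_curve L \<gamma>"
proof -
  have "B-lipschitz_on {0..L} \<gamma>" if "B-lipschitz_on {0..L} \<rho>" for B
    using that eq by (simp add: lipschitz_on_def)
  moreover have "(\<gamma> has_vector_derivative v) (at s)"
    if "(\<rho> has_vector_derivative v) (at s)" "s \<in> {0<..<L}" for v s
    using that by (rule has_vector_derivative_cong_interval) (use eq in auto)
  moreover obtain B N where "0 \<le> L" "B-lipschitz_on {0..L} \<rho>" "negligible N"
    "\<forall>s\<in>{0<..<L} - N. \<exists>v. (\<rho> has_vector_derivative v) (at s) \<and> norm v = 1"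
    using assms(1) unfolding unit_speed_curve_iff by blast
  ultimately show ?thesis
    unfolding unit_speed_curve_iff by (intro conjI exI[of _ B] exI[of _ N]) blast+
qed

lemma has_vector_derivative_shift:
  assumes "(f has_vector_derivative v) (at (a + s))"
  shows "((\<lambda>s. f (a + s)) has_vector_derivative v) (at (s::real))"
proof -
  have "((\<lambda>s. a + s) has_real_derivative 1) (at s)"
    by (auto intro!: derivative_eq_intros)
  then have "(f \<circ> (\<lambda>s. a + s) has_vector_derivative (1 *\<^sub>R v)) (at s)"
    by (intro vector_diff_chain_at)
      (use assms in \<open>simp_all add: has_real_derivative_iff_has_vector_derivative\<close>)
  then show ?thesis by (simp add: o_def)
qed

lemma negligible_real_translation:
  "negligible N \<Longrightarrow> negligible {s. a + s \<in> (N :: real set)}"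
proof -
  assume "negligible N"
  then have "negligible ((+) (- a) ` N)" by (rule negligible_translation)
  moreover have "{s. a + s \<in> N} \<subseteq> (+) (- a) ` N"
  proof
    fix s assume "s \<in> {s. a + s \<in> N}"
    then show "s \<in> (+) (- a) ` N"
      by (intro image_eqI[of _ _ "a + s"]) auto
  qed
  ultimately show ?thesis by (rule negligible_subset)
qed

lemma unit_speed_curve_tail:
  assumes "unit_speed_curve L \<rho>" "0 \<le> a" "a \<le> L"
  shows "unit_speed_curve (L - a) (\<lambda>s. \<rho> (a + s))"
proof -
  obtain B N where B: "B-lipschitz_on {0..L} \<rho>" and N: "negligible N"
    "\<forall>s\<in>{0<..<L} - N. \<exists>v. (\<rho> has_vector_derivative v) (at s) \<and> norm v = 1"
    using assms(1) unfolding unit_speed_curve_iff by blast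
  have "B-lipschitz_on {0..L-a} (\<lambda>s. \<rho> (a + s))"
    using lipschitz_on_nonneg[OF B] lipschitz_onD[OF B, of "a + s" "a + r" for s r] assms(2)
    by (intro lipschitz_onI) (simp_all add: dist_real_def)
  moreover have "\<exists>v. ((\<lambda>s. \<rho> (a + s)) has_vector_derivative v) (at s) \<and> norm v = 1"
    if "s \<in> {0<..<L - a} - {s. a + s \<in> N}" for s
  proof -
    have "a + s \<in> {0<..<L} - N" using that assms(2) by auto
    with N(2) obtain v where "(\<rho> has_vector_derivative v) (at (a + s))" "norm v = 1" by blast
    then show ?thesis by (blast intro: has_vector_derivative_shift)
  qed
  ultimately show ?thesis
    using assms(3) negligible_real_translation[OF N(1), of a] unfolding unit_speed_curve_iff by force
qed

lemma unit_speed_curve_initial: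
  assumes "unit_speed_curve L \<rho>" "0 \<le> a" "a \<le> L"
  shows "unit_speed_curve a \<rho>"
proof -
  obtain B N where "B-lipschitz_on {0..L} \<rho>" and N: "negligible N"
    "\<forall>s\<in>{0<..<L} - N. \<exists>v. (\<rho> has_vector_derivative v) (at s) \<and> norm v = 1"
    using assms(1) unfolding unit_speed_curve_iff by blast
  then have "B-lipschitz_on {0..a} \<rho>"
    using assms(3) by (auto intro: lipschitz_on_subset)
  with N assms(2,3) show ?thesis
    unfolding unit_speed_curve_iff by (intro conjI exI[of _ B] exI[of _ N]) auto
qed

definition join_curves :: "real \<Rightarrow> (real \<Rightarrow> 'a) \<Rightarrow> (real \<Rightarrow> 'a) \<Rightarrow> real \<Rightarrow> 'a" where
  "join_curves a \<rho> \<gamma> s = (if s \<le> a then \<rho> s else \<gamma> (s - a))"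

lemma unit_speed_curve_join:
  assumes \<rho>: "unit_speed_curve a \<rho>" and \<gamma>: "unit_speed_curve b \<gamma>" and eq: "\<rho> a = \<gamma> 0"
  shows "unit_speed_curve (a + b) (join_curves a \<rho> \<gamma>)"
proof -
  let ?j = "join_curves a \<rho> \<gamma>"
  obtain B N where B: "B-lipschitz_on {0..a} \<rho>" and N: "negligible N" and a: "0 \<le> a" and
    Nd: "\<forall>s\<in>{0<..<a} - N. \<exists>v. (\<rho> has_vector_derivative v) (at s) \<and> norm v = 1"
    using \<rho> unfolding unit_speed_curve_iff by blast
  obtain C M where C: "C-lipschitz_on {0..b} \<gamma>" and M: "negligible M" and b: "0 \<le> b" and
    Md: "\<forall>s\<in>{0<..<b} - M. \<exists>v. (\<gamma> has_vector_derivative v) (at s) \<and> norm v = 1"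
    using \<gamma> unfolding unit_speed_curve_iff by blast
  have "C-lipschitz_on {a..a+b} (\<lambda>s. \<gamma> (s - a))"
    using lipschitz_on_nonneg[OF C] lipschitz_onD[OF C, of "s - a" "r - a" for s r]
    by (intro lipschitz_onI) (simp_all add: dist_real_def)
  then have "(max B C)-lipschitz_on {0..a+b} (\<lambda>s. if s \<le> a then \<rho> s else \<gamma> (s - a))"
    using B eq by (intro lipschitz_on_concat_max) auto
  then have lip: "(max B C)-lipschitz_on {0..a+b} ?j"
    by (simp add: join_curves_def[abs_def])
  let ?E = "insert a (N \<union> {s. - a + s \<in> M})"
  have E: "negligible ?E"
    using N negligible_real_translation[OF M, of "- a"] by (simp add: negligible_Un)
  have "\<exists>v. (?j has_vector_derivative v) (at s) \<and> norm v = 1"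
    if s: "s \<in> {0<..<a+b} - ?E" for s
  proof (cases "s < a")
    case True
    with s have "s \<in> {0<..<a} - N" by auto
    with Nd obtain v where v: "(\<rho> has_vector_derivative v) (at s)" "norm v = 1" by blast
    have "(?j has_vector_derivative v) (at s)"
      by (rule has_vector_derivative_cong_interval[OF v(1), of 0 a])
        (use s True in \<open>auto simp: join_curves_def\<close>)
    with v(2) show ?thesis by blast
  next
    case False
    with s have "- a + s \<in> {0<..<b} - M" by auto
    with Md obtain v where v: "(\<gamma> has_vector_derivative v) (at (- a + s))" "norm v = 1" by blast
    have "(?j has_vector_derivative v) (at s)"
      by (rule has_vector_derivative_cong_interval[OF has_vector_derivative_shift[OF v(1)], of a "a + b"])
        (use s False in \<open>auto simp: join_curves_def\<close>)
    with v(2) show ?thesis by blast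
  qed
  with lip E a b show ?thesis
    unfolding unit_speed_curve_iff by (metis add_nonneg_nonneg)
qed

definition segment_curve :: "'a::real_normed_vector \<Rightarrow> 'a \<Rightarrow> real \<Rightarrow> 'a" where
  "segment_curve x y s = x + s *\<^sub>R sgn (y - x)"

lemma segment_curve_0 [simp]: "segment_curve x y 0 = x"
  by (simp add: segment_curve_def)

lemma segment_curve_end [simp]: "segment_curve x y (dist x y) = y"
  by (cases "x = y") (simp_all add: segment_curve_def sgn_div_norm dist_norm norm_minus_commute)

lemma segment_curve_dist_start: "s \<in> {0..dist x y} \<Longrightarrow> dist x (segment_curve x y s) = s"
  by (cases "x = y") (auto simp: segment_curve_def dist_norm norm_sgn)

lemma unit_speed_segment_curve:
  fixes x y :: "'a::euclidean_space"
  shows "unit_speed_curve (dist x y) (segment_curve x y)"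
proof -
  have "1-lipschitz_on {0..dist x y} (segment_curve x y)"
    by (rule lipschitz_onI)
      (auto simp: segment_curve_def dist_norm norm_sgn simp flip: scaleR_diff_left)
  moreover have "(segment_curve x y has_vector_derivative sgn (y - x)) (at s)" for s
    unfolding segment_curve_def[abs_def] by (auto intro!: derivative_eq_intros)
  ultimately show ?thesis
    unfolding unit_speed_curve_iff
    by (intro conjI exI[of _ 1] exI[of _ "{}"]) (auto simp: norm_sgn intro!: exI[of _ "sgn (y - x)"])
qed

lemma negligible_open_cover_small:
  fixes N :: "real set"
  assumes "negligible N" "0 < e"
  obtains T where "open T" "N \<subseteq> T" "T \<in> lmeasurable" "measure lebesgue T < e"
proof -
  have "N \<in> sets lebesgue" using assms(1) by (simp add: negligible_iff_null_sets null_sets_def)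
  then obtain T where T: "open T" "N \<subseteq> T" "T - N \<in> lmeasurable" "emeasure lebesgue (T - N) < ennreal e"
    using sets_lebesgue_outer_open assms(2) by blast
  have N: "N \<in> lmeasurable" "measure lebesgue N = 0"
    using assms(1) negligible_iff_measure by blast+
  then have TL: "T \<in> lmeasurable"
    using fmeasurable.Un[OF T(3) N(1)] T(2) by (simp add: Un_absorb2)
  have "measure lebesgue T = measure lebesgue (T - N)"
    using assms(1) TL by (simp add: measure_Diff_null_set negligible_iff_null_sets fmeasurableD)
  also have "\<dots> < e"
    using T(3,4) assms(2) by (simp add: emeasure_eq_measure2 ennreal_less_iff)
  finally show ?thesis using T(1,2) TL that by blast
qed

text \<open>
  A Lipschitz curve has no singular part, so an almost everywhere bound on its derivative controls
  its increments.  The exceptional null set is covered by an open set \<open>T\<close> of small measure, and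
  the estimate below, whose right-hand side is additive in the interval, holds on all short
  intervals around a given point: by differentiability off the null set, and by the crude
  Lipschitz bound \<open>B\<close> inside \<open>T\<close>.
\<close>

lemma unit_speed_curve_dist_le:
  fixes \<rho> :: "real \<Rightarrow> 'a::euclidean_space"
  assumes "unit_speed_curve L \<rho>" "0 \<le> a" "a \<le> b" "b \<le> L"
  shows "dist (\<rho> a) (\<rho> b) \<le> b - a"
proof -
  obtain B N where B: "B-lipschitz_on {0..L} \<rho>" and N: "negligible N"
    "\<forall>s\<in>{0<..<L} - N. \<exists>v. (\<rho> has_vector_derivative v) (at s) \<and> norm v = 1"
    using assms(1) unfolding unit_speed_curve_iff by blast
  have Bd: "dist (\<rho> s) (\<rho> r) \<le> B * (r - s)" if "0 \<le> s" "s \<le> r" "r \<le> L" for s r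
    using lipschitz_onD[OF B, of s r] that by (simp add: dist_real_def)
  have B0: "B \<ge> 0" using lipschitz_on_nonneg[OF B] .
  have main: "dist (\<rho> a) (\<rho> b) \<le> (1 + e) * (b - a) + B * e" if e: "0 < e" for e
  proof -
    \<comment> \<open>The end points of \<open>{0..L}\<close> count as exceptional: nothing is known about the derivative there.\<close>
    have "negligible (insert 0 (insert L N))" using N(1) by simp
    then obtain T where T: "open T" "insert 0 (insert L N) \<subseteq> T" "T \<in> lmeasurable" "measure lebesgue T < e"
      using negligible_open_cover_small e by blast
    \<comment> \<open>Half-open intervals make \<open>?m\<close> exactly additive.\<close>
    let ?m = "\<lambda>s r. measure lebesgue (T \<inter> {s<..r})"
    let ?P = "\<lambda>s r. 0 \<le> s \<and> s \<le> r \<and> r \<le> L \<longrightarrow> dist (\<rho> s) (\<rho> r) \<le> (1 + e) * (r - s) + B * ?m s r"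
    have fm: "T \<inter> {s<..r} \<in> lmeasurable" for s r
      by (rule fmeasurable_Int_fmeasurable[OF T(3)]) auto
    have "?P a b"
      using assms(3)
    proof (induction rule: Bolzano)
      case (trans p q r)
      show ?case
      proof
        assume r: "0 \<le> p \<and> p \<le> r \<and> r \<le> L"
        have "T \<inter> {p<..r} = T \<inter> {p<..q} \<union> T \<inter> {q<..r}"
          and "(T \<inter> {p<..q}) \<inter> (T \<inter> {q<..r}) = {}"
          using trans(3,4) by auto
        then have "?m p r = ?m p q + ?m q r"
          using measure_Un3[OF fm[of p q] fm[of q r]] by simp
        moreover have "dist (\<rho> p) (\<rho> r) \<le> dist (\<rho> p) (\<rho> q) + dist (\<rho> q) (\<rho> r)"
          by (rule dist_triangle)
        ultimately show "dist (\<rho> p) (\<rho> r) \<le> (1 + e) * (r - p) + B * ?m p r"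
          using trans r by (simp add: algebra_simps)
      qed
    next
      case (local x)
      show ?case
      proof (cases "x \<in> T")
        case True
        then obtain d where d: "d > 0" "ball x d \<subseteq> T"
          using T(1) openE by blast
        have "?P s r" if "s \<le> x \<and> x \<le> r \<and> r - s < d" for s r
        proof
          assume sr: "0 \<le> s \<and> s \<le> r \<and> r \<le> L"
          have "{s<..r} \<subseteq> ball x d" using that by (auto simp: dist_real_def)
          then have "T \<inter> {s<..r} = {s<..r}" using d by auto
          then have "?m s r = r - s" using sr by simp
          then show "dist (\<rho> s) (\<rho> r) \<le> (1 + e) * (r - s) + B * ?m s r"
            using Bd[of s r] sr e by (simp add: add_increasing)
        qed
        with d(1) show ?thesis by blast
      next
        case False
        then have "x \<in> {0<..<L} - N"
          using T(2) local assms(2,4) by (auto simp: less_le)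
        then obtain v where v: "(\<rho> has_vector_derivative v) (at x)" "norm v = 1"
          using N(2) by blast
        then obtain d where d: "d > 0"
          "\<And>y. norm (y - x) < d \<Longrightarrow> norm (\<rho> y - \<rho> x - (y - x) *\<^sub>R v) \<le> e * norm (y - x)"
          using e unfolding has_vector_derivative_def has_derivative_at_alt by blast
        have near: "dist (\<rho> y) (\<rho> x) \<le> (1 + e) * \<bar>y - x\<bar>" if "\<bar>y - x\<bar> < d" for y
        proof -
          have "norm (\<rho> y - \<rho> x) \<le> norm (\<rho> y - \<rho> x - (y - x) *\<^sub>R v) + norm ((y - x) *\<^sub>R v)"
            by (metis norm_triangle_sub add.commute)
          then show ?thesis
            using d(2)[of y] that v(2) by (simp add: dist_norm distrib_right)
        qed
        have "?P s r" if "s \<le> x \<and> x \<le> r \<and> r - s < d" for s r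
        proof
          assume "0 \<le> s \<and> s \<le> r \<and> r \<le> L"
          have "dist (\<rho> s) (\<rho> r) \<le> dist (\<rho> s) (\<rho> x) + dist (\<rho> r) (\<rho> x)"
            by (rule dist_triangle2)
          also have "\<dots> \<le> (1 + e) * (x - s) + (1 + e) * (r - x)"
            using near[of s] near[of r] that by simp
          also have "\<dots> = (1 + e) * (r - s)" by (simp add: algebra_simps)
          finally show "dist (\<rho> s) (\<rho> r) \<le> (1 + e) * (r - s) + B * ?m s r"
            using B0 by (simp add: add_increasing2)
        qed
        with d(1) show ?thesis by blast
      qed
    qed
    then have "dist (\<rho> a) (\<rho> b) \<le> (1 + e) * (b - a) + B * ?m a b"
      using assms by blast
    moreover have "?m a b \<le> measure lebesgue T"
      by (rule measure_mono_fmeasurable) (use T(3) fm in \<open>auto simp: fmeasurableD\<close>)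
    then have "B * ?m a b \<le> B * e"
      using T(4) B0 by (intro mult_left_mono) auto
    ultimately show ?thesis by simp
  qed
  have "((\<lambda>e. (1 + e) * (b - a) + B * e) \<longlongrightarrow> (1 + 0) * (b - a) + B * 0) (at_right 0)"
    by (intro tendsto_intros)
  moreover have "\<forall>\<^sub>F e in at_right 0. dist (\<rho> a) (\<rho> b) \<le> (1 + e) * (b - a) + B * e"
    using main by (auto intro: eventually_at_rightI[of 0 1])
  ultimately show ?thesis
    by (intro tendsto_lowerbound[of _ "b - a" "at_right 0"]) auto
qed

lemma segment_curve_dist_end:
  fixes x y :: "'a::euclidean_space"
  shows "s \<in> {0..dist x y} \<Longrightarrow> dist (segment_curve x y s) y \<le> dist x y - s"
  using unit_speed_curve_dist_le[OF unit_speed_segment_curve, of s "dist x y" x y] by simp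

section \<open>The cost of a curve\<close>

locale elliptic_hamiltonian =
  fixes H :: "'a::euclidean_space \<Rightarrow> 'a \<Rightarrow> real" and \<alpha>_lo \<alpha>_hi :: real
  assumes closed_sublevel: "closed (sublevel H)"
    and \<alpha>_lo_pos: "0 < \<alpha>_lo" and \<alpha>_le: "\<alpha>_lo \<le> \<alpha>_hi"
    and ball_subset_sublevel_at: "ball 0 (1 / \<alpha>_hi) \<subseteq> sublevel_at H x"
    and sublevel_at_subset_ball: "sublevel_at H x \<subseteq> ball 0 (1 / \<alpha>_lo)"
begin

lemma \<alpha>_hi_pos: "0 < \<alpha>_hi"
  using \<alpha>_lo_pos \<alpha>_le by simp

lemma mem_sublevel: "(x, p) \<in> sublevel H \<longleftrightarrow> p \<in> sublevel_at H x"
  by (simp add: sublevel_def sublevel_at_def)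

lemma compact_sublevel_at: "compact (sublevel_at H x)"
proof -
  have "closed (Pair x -` sublevel H)"
    by (intro closed_vimage closed_sublevel continuous_intros)
  also have "Pair x -` sublevel H = sublevel_at H x"
    by (auto simp: mem_sublevel)
  finally show ?thesis
    using sublevel_at_subset_ball[of x] bounded_subset[OF bounded_ball] by (simp add: compact_eq_bounded_closed)
qed

lemma support_fun_attained:
  obtains p where "p \<in> sublevel_at H x" "support_fun H x v = - (p \<bullet> v)"
    "\<And>q. q \<in> sublevel_at H x \<Longrightarrow> - (q \<bullet> v) \<le> support_fun H x v"
proof -
  have "sublevel_at H x \<noteq> {}"
    using ball_subset_sublevel_at[of x] centre_in_ball[of 0 "1 / \<alpha>_hi"] \<alpha>_hi_pos by auto
  moreover have "continuous_on (sublevel_at H x) (\<lambda>p. - (p \<bullet> v))"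
    by (intro continuous_intros)
  ultimately obtain p where p: "p \<in> sublevel_at H x"
    "\<forall>q\<in>sublevel_at H x. - (q \<bullet> v) \<le> - (p \<bullet> v)"
    using continuous_attains_sup[OF compact_sublevel_at] by blast
  have "support_fun H x v = - (p \<bullet> v)"
    unfolding support_fun_def by (rule cSup_eq_maximum) (use p in auto)
  with p that show ?thesis by auto
qed

lemma support_fun_ge_iff:
  "c \<le> support_fun H x v \<longleftrightarrow> (\<exists>p\<in>sublevel_at H x. c \<le> - (p \<bullet> v))"
  by (rule support_fun_attained[of x v]) force

lemma support_fun_bounds:
  assumes "norm v = 1"
  shows "1 / \<alpha>_hi \<le> support_fun H x v" "support_fun H x v \<le> 1 / \<alpha>_lo"
proof -
  \<comment> \<open>The momentum giving the lower bound has norm \<open>1 / \<alpha>_hi\<close>, hence the passage to the closed ball.\<close>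
  have "cball 0 (1 / \<alpha>_hi) \<subseteq> sublevel_at H x"
    using closure_minimal[OF ball_subset_sublevel_at[of x] compact_imp_closed[OF compact_sublevel_at]]
      \<alpha>_hi_pos by (simp add: closure_ball)
  moreover have "- (1 / \<alpha>_hi) *\<^sub>R v \<in> cball 0 (1 / \<alpha>_hi)"
    using assms \<alpha>_hi_pos by simp
  ultimately have "- (1 / \<alpha>_hi) *\<^sub>R v \<in> sublevel_at H x" by blast
  moreover have "1 / \<alpha>_hi \<le> - ((- (1 / \<alpha>_hi) *\<^sub>R v) \<bullet> v)"
    using assms by (simp add: dot_square_norm)
  ultimately show "1 / \<alpha>_hi \<le> support_fun H x v"
    unfolding support_fun_ge_iff by blast
  obtain p where p: "p \<in> sublevel_at H x" "support_fun H x v = - (p \<bullet> v)"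
    by (rule support_fun_attained)
  have "- (p \<bullet> v) \<le> norm p * norm v"
    using Cauchy_Schwarz_ineq2[of p v] by simp
  also have "\<dots> \<le> 1 / \<alpha>_lo"
    using p(1) sublevel_at_subset_ball[of x] assms by (auto simp: subset_eq less_imp_le)
  finally show "support_fun H x v \<le> 1 / \<alpha>_lo" using p(2) by simp
qed

text \<open>
  Closedness of the sublevel set makes the support function upper semicontinuous in both variables
  jointly: its superlevel sets are projections of closed sets along the compact set in which the
  momenta range.  Measurability is essential: the integral of a function that is not integrable is zero
  by convention, and such a curve would cost nothing.
\<close>

lemma borel_measurable_support_fun:
  "(\<lambda>(x, v). support_fun H x v) \<in> borel_measurable borel"
proof (rule borel_measurableI_ge)
  fix c :: real
  let ?T = "{(p, x, v). p \<in> sublevel_at H x \<and> c \<le> - (p \<bullet> v)} :: ('a \<times> 'a \<times> 'a) set"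
  have "?T = (\<lambda>(p, x, v). (x, p)) -` sublevel H \<inter> {z. c \<le> - (fst z \<bullet> snd (snd z))}"
    by (auto simp: mem_sublevel)
  moreover have "closed \<dots>"
    by (intro closed_Int closed_vimage closed_sublevel closed_Collect_le)
      (auto simp: case_prod_beta intro!: continuous_intros)
  ultimately have "closed ?T" by simp
  have bounded: "norm p \<le> 1 / \<alpha>_lo" if "p \<in> sublevel_at H x" for p x
    using sublevel_at_subset_ball[of x] that by (auto simp: subset_eq less_imp_le)
  from \<open>closed ?T\<close> have "closed {y. \<exists>p. p \<in> cball 0 (1 / \<alpha>_lo) \<and> (p, y) \<in> ?T}"
    by (rule closed_compact_projection[OF compact_cball])
  also have "{y. \<exists>p. p \<in> cball 0 (1 / \<alpha>_lo) \<and> (p, y) \<in> ?T}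
      = {y \<in> space borel. c \<le> (case y of (x, v) \<Rightarrow> support_fun H x v)}"
    using bounded by (simp add: support_fun_ge_iff Bex_def split_beta) blast
  finally show "{y \<in> space borel. c \<le> (case y of (x, v) \<Rightarrow> support_fun H x v)} \<in> sets borel"
    by (rule borel_closed)
qed

definition cost_density :: "(real \<Rightarrow> 'a) \<Rightarrow> real \<Rightarrow> real" where
  "cost_density \<rho> s = support_fun H (\<rho> s) (vector_derivative \<rho> (at s))"

text \<open>
  The derivative of a curve is a pointwise limit of difference quotients, hence measurable.  The
  quotients are formed from an extension of the curve by constants, since nothing is known about
  the given one outside the parameter interval.
\<close>

lemma cost_density_measurable:
  assumes L: "0 \<le> L" and lip: "B-lipschitz_on {0..L} \<rho>" and S: "S \<in> sets lebesgue" "S \<subseteq> {0<..<L}"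
    and diff: "\<And>s. s \<in> S \<Longrightarrow> \<rho> differentiable (at s)"
  shows "cost_density \<rho> \<in> borel_measurable (lebesgue_on S)"
proof -
  define \<gamma> where "\<gamma> s = \<rho> (max 0 (min L s))" for s
  have "continuous_on UNIV \<gamma>"
    unfolding \<gamma>_def[abs_def]
    by (rule continuous_on_compose2[OF lipschitz_on_continuous_on[OF lip]])
      (use L in \<open>auto intro!: continuous_intros\<close>)
  then have "continuous_on S (\<lambda>s. \<gamma> (s + c))" for c
    by (rule continuous_on_compose2) (intro continuous_intros, simp)
  then have meas: "(\<lambda>s. \<gamma> (s + c)) \<in> borel_measurable (lebesgue_on S)" for c
    by (intro continuous_imp_measurable_on_sets_lebesgue S(1))
  have eq: "\<gamma> s = \<rho> s" if "s \<in> {0<..<L}" for s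
    using that by (simp add: \<gamma>_def)
  define Q where "Q n s = real (Suc n) *\<^sub>R (\<gamma> (s + inverse (real (Suc n))) - \<gamma> (s + 0))" for n s
  have lim: "(\<lambda>n. Q n s) \<longlonglongrightarrow> vector_derivative \<rho> (at s)" if s: "s \<in> S" for s
  proof -
    have "(\<rho> has_vector_derivative vector_derivative \<rho> (at s)) (at s)"
      using diff[OF s] by (simp add: vector_derivative_works)
    then have "(\<gamma> has_vector_derivative vector_derivative \<rho> (at s)) (at s)"
      by (rule has_vector_derivative_cong_interval[of _ _ _ 0 L]) (use s S(2) eq in auto)
    then have "((\<lambda>h. (\<gamma> (s + h) - \<gamma> s) /\<^sub>R h) \<longlongrightarrow> vector_derivative \<rho> (at s)) (at 0)"
      by (rule has_vector_derivative_imp_quotient_limit)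
    moreover have "filterlim (\<lambda>n. inverse (real (Suc n))) (at 0) sequentially"
      using LIMSEQ_inverse_real_of_nat by (simp add: filterlim_at)
    ultimately have "(\<lambda>n. (\<gamma> (s + inverse (real (Suc n))) - \<gamma> s) /\<^sub>R inverse (real (Suc n)))
        \<longlonglongrightarrow> vector_derivative \<rho> (at s)"
      by (rule filterlim_compose)
    then show ?thesis by (simp add: Q_def)
  qed
  have Q: "Q n \<in> borel_measurable (lebesgue_on S)" for n
    unfolding Q_def
    by (rule borel_measurable_scaleR[OF borel_measurable_const borel_measurable_diff[OF meas meas]])
  have "(\<lambda>s. vector_derivative \<rho> (at s)) \<in> borel_measurable (lebesgue_on S)"
    by (rule borel_measurable_LIMSEQ_metric[OF Q lim]) simp
  moreover have "\<rho> \<in> borel_measurable (lebesgue_on S)"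
    by (rule measurable_cong[THEN iffD1, OF _ meas[of 0]]) (use eq S(2) in auto)
  ultimately have "(\<lambda>s. (\<rho> s, vector_derivative \<rho> (at s))) \<in> borel_measurable (lebesgue_on S)"
    by (rule borel_measurable_Pair[rotated])
  from measurable_compose[OF this borel_measurable_support_fun] show ?thesis
    by (simp add: cost_density_def[abs_def])
qed

lemma cost_density_integrable:
  assumes "unit_speed_curve L \<rho>"
  shows "cost_density \<rho> absolutely_integrable_on {0..L}"
    and "L / \<alpha>_hi \<le> integral {0..L} (cost_density \<rho>)"
    and "integral {0..L} (cost_density \<rho>) \<le> L / \<alpha>_lo"
proof -
  obtain B N where B: "B-lipschitz_on {0..L} \<rho>" and N: "negligible N" and L: "0 \<le> L" and
    Nd: "\<forall>s\<in>{0<..<L} - N. \<exists>v. (\<rho> has_vector_derivative v) (at s) \<and> norm v = 1"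
    using assms unfolding unit_speed_curve_iff by blast
  let ?S = "{0<..<L} - N"
  have bds: "1 / \<alpha>_hi \<le> cost_density \<rho> s \<and> cost_density \<rho> s \<le> 1 / \<alpha>_lo" if "s \<in> ?S" for s
  proof -
    obtain v where "(\<rho> has_vector_derivative v) (at s)" "norm v = 1"
      using Nd \<open>s \<in> ?S\<close> by blast
    then show ?thesis
      using support_fun_bounds by (simp add: cost_density_def vector_derivative_at)
  qed
  have S: "?S \<in> lmeasurable"
    using bounded_set_imp_lmeasurable[of "{0<..<L}"] negligible_imp_measurable[OF N]
    by (simp add: fmeasurable.Diff)
  have "cost_density \<rho> absolutely_integrable_on ?S"
  proof (rule measurable_bounded_by_integrable_imp_absolutely_integrable)
    show "cost_density \<rho> \<in> borel_measurable (lebesgue_on ?S)"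
    proof (rule cost_density_measurable[OF L B])
      show "\<rho> differentiable (at s)" if "s \<in> ?S" for s
        using Nd that by (blast intro: differentiableI_vector)
    qed (use S in \<open>auto dest: fmeasurableD\<close>)
    show "(\<lambda>_. 1 / \<alpha>_lo) integrable_on ?S"
      using S by (rule integrable_on_const)
    show "norm (cost_density \<rho> s) \<le> 1 / \<alpha>_lo" if "s \<in> ?S" for s
      using bds[OF that] \<alpha>_hi_pos by (smt (verit) divide_pos_pos real_norm_def)
  qed (use S in auto)
  moreover have N': "negligible (insert 0 (insert L N))" using N by simp
  ultimately show int: "cost_density \<rho> absolutely_integrable_on {0..L}"
    by (elim absolutely_integrable_spike_set) (auto intro: negligible_subset[OF N'])
  \<comment> \<open>The bounds hold off a null set only; \<open>?c\<close> satisfies them everywhere and has the same integral.\<close>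
  let ?c = "\<lambda>s. if s \<in> ?S then cost_density \<rho> s else 1 / \<alpha>_hi"
  have eq: "integral {0..L} (cost_density \<rho>) = integral {0..L} ?c"
    by (rule integral_spike[OF N']) auto
  have c: "?c integrable_on {0..L}"
    by (rule integrable_spike[OF set_lebesgue_integral_eq_integral(1)[OF int] N']) auto
  have c_bds: "1 / \<alpha>_hi \<le> ?c s \<and> ?c s \<le> 1 / \<alpha>_lo" for s
    using bds[of s] \<alpha>_lo_pos \<alpha>_le by (simp add: frac_le)
  have "integral {0..L} (\<lambda>_. 1 / \<alpha>_hi) \<le> integral {0..L} ?c"
    by (rule integral_le[OF _ c]) (use c_bds in auto)
  moreover have "integral {0..L} ?c \<le> integral {0..L} (\<lambda>_. 1 / \<alpha>_lo)"
    by (rule integral_le[OF c]) (use c_bds in auto)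
  ultimately show "L / \<alpha>_hi \<le> integral {0..L} (cost_density \<rho>)"
    "integral {0..L} (cost_density \<rho>) \<le> L / \<alpha>_lo"
    using L by (simp_all add: eq)
qed

lemma curve_cost_eq_integral:
  "unit_speed_curve L \<rho> \<Longrightarrow> curve_cost H L \<rho> = integral {0..L} (cost_density \<rho>)"
  using set_lebesgue_integral_eq_integral(2)[OF cost_density_integrable(1)]
  by (simp add: curve_cost_def cost_density_def)

lemma curve_cost_bounds:
  assumes "unit_speed_curve L \<rho>"
  shows "L / \<alpha>_hi \<le> curve_cost H L \<rho>" "curve_cost H L \<rho> \<le> L / \<alpha>_lo"
  using cost_density_integrable[OF assms] by (simp_all add: curve_cost_eq_integral[OF assms])

lemma curve_cost_cong:
  assumes "unit_speed_curve L \<rho>" and eq: "\<And>s. s \<in> {0..L} \<Longrightarrow> \<rho> s = \<gamma> s"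
  shows "curve_cost H L \<rho> = curve_cost H L \<gamma>"
proof -
  have "cost_density \<gamma> s = cost_density \<rho> s" if "s \<in> {0..L} - {0, L}" for s
    using vector_derivative_cong_interval[of s 0 L \<rho> \<gamma>] that eq
    by (auto simp: cost_density_def)
  then have "integral {0..L} (cost_density \<rho>) = integral {0..L} (cost_density \<gamma>)"
    by (intro integral_spike[of "{0, L}"]) auto
  then show ?thesis
    using curve_cost_eq_integral unit_speed_curve_cong assms by metis
qed

lemma cost_density_shift: "cost_density (\<lambda>s. \<rho> (a + s)) s = cost_density \<rho> (a + s)"
proof -
  have "((\<lambda>s. \<rho> (a + s)) has_vector_derivative v) (at s) \<longleftrightarrow> (\<rho> has_vector_derivative v) (at (a + s))"
    for v
    using has_vector_derivative_shift[of \<rho> v a s]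
      has_vector_derivative_shift[of "\<lambda>s. \<rho> (a + s)" v "- a" "a + s"] by auto
  then show ?thesis by (simp add: cost_density_def vector_derivative_def)
qed

text \<open>
  Additivity of the cost is proved for cutting a curve, where the density does not change;
  concatenation is then the special case of cutting the joined curve at the junction.
\<close>

lemma curve_cost_split:
  assumes "unit_speed_curve L \<rho>" and a: "0 \<le> a" and "a \<le> L"
  shows "curve_cost H L \<rho> = curve_cost H a \<rho> + curve_cost H (L - a) (\<lambda>s. \<rho> (a + s))"
proof -
  have shift: "cost_density (\<lambda>s. \<rho> (a + s)) = (\<lambda>s. cost_density \<rho> (s + a))"
    by (rule ext) (subst cost_density_shift, subst add.commute, rule refl)
  have "integral {0..L} (cost_density \<rho>)
      = integral {0..a} (cost_density \<rho>) + integral {a..L} (cost_density \<rho>)"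
    using Henstock_Kurzweil_Integration.integral_combine[OF a assms(3)]
      set_lebesgue_integral_eq_integral(1)[OF cost_density_integrable(1)[OF assms(1)]] by metis
  also have "integral {a..L} (cost_density \<rho>) = integral {0..L - a} (cost_density (\<lambda>s. \<rho> (a + s)))"
    using integral_shift_real_ivl[of a a L "cost_density \<rho>"] by (simp add: shift)
  finally show ?thesis
    using assms unit_speed_curve_initial[OF assms] unit_speed_curve_tail[OF assms]
    by (simp add: curve_cost_eq_integral)
qed

lemma curve_cost_join:
  assumes "unit_speed_curve a \<rho>" "unit_speed_curve b \<gamma>" "\<rho> a = \<gamma> 0"
  shows "curve_cost H (a + b) (join_curves a \<rho> \<gamma>) = curve_cost H a \<rho> + curve_cost H b \<gamma>"
proof -
  let ?j = "join_curves a \<rho> \<gamma>"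
  have ab: "0 \<le> a" "0 \<le> b" using assms by (simp_all add: unit_speed_curve_def)
  have "curve_cost H (a + b) ?j = curve_cost H a ?j + curve_cost H (a + b - a) (\<lambda>s. ?j (a + s))"
    using unit_speed_curve_join[OF assms] by (rule curve_cost_split) (use ab in auto)
  moreover have "curve_cost H a \<rho> = curve_cost H a ?j"
    using assms(1) by (rule curve_cost_cong) (simp add: join_curves_def)
  moreover have "curve_cost H b \<gamma> = curve_cost H b (\<lambda>s. ?j (a + s))"
    using assms(2) by (rule curve_cost_cong) (use assms(3) in \<open>auto simp: join_curves_def\<close>)
  ultimately show ?thesis by simp
qed

lemma hj_solution_le_curve_cost:
  assumes "unit_speed_curve L \<rho>" "\<rho> L \<in> K"
  shows "hj_solution H K (\<rho> 0) \<le> curve_cost H L \<rho>"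
proof -
  have "0 \<le> curve_cost H L \<rho>" if "unit_speed_curve L \<rho>" for L \<rho>
    using curve_cost_bounds(1)[OF that] that \<alpha>_hi_pos
    by (smt (verit) divide_nonneg_pos unit_speed_curve_def)
  then show ?thesis
    unfolding hj_solution_def using assms by (intro cInf_lower bdd_belowI[of _ 0]) auto
qed

lemma hj_solution_less_obtain_curve:
  assumes "K \<noteq> {}" "hj_solution H K x < t"
  obtains L \<rho> where "unit_speed_curve L \<rho>" "\<rho> 0 = x" "\<rho> L \<in> K" "curve_cost H L \<rho> < t"
proof -
  let ?C = "{curve_cost H L \<rho> | L \<rho>. unit_speed_curve L \<rho> \<and> \<rho> 0 = x \<and> \<rho> L \<in> K}"
  obtain y where y: "y \<in> K" using assms(1) by blast
  have "curve_cost H (dist x y) (segment_curve x y) \<in> ?C"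
    using unit_speed_segment_curve[of x y] y
      by (intro CollectI exI[of _ "dist x y"] exI[of _ "segment_curve x y"]) simp
  then obtain c where "c \<in> ?C" "c < t"
    using cInf_lessD[of ?C t] assms(2) unfolding hj_solution_def by blast
  then show ?thesis using that by blast
qed

lemma hj_solution_nonpos_on_target:
  assumes "y \<in> K"
  shows "hj_solution H K y \<le> 0"
  using hj_solution_le_curve_cost[OF unit_speed_segment_curve, of y y K]
    curve_cost_bounds(2)[OF unit_speed_segment_curve, of y y] assms by (simp add: segment_curve_def)

text \<open>Prepending the segment from \<open>y\<close> to \<open>z\<close> to a nearly optimal curve from \<open>z\<close> gives a competitor at \<open>y\<close>.\<close>

lemma hj_solution_lipschitz:
  assumes "K \<noteq> {}"
  shows "hj_solution H K y \<le> hj_solution H K z + dist y z / \<alpha>_lo"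
proof (rule field_le_epsilon)
  fix e :: real assume "0 < e"
  then obtain L \<rho> where \<rho>: "unit_speed_curve L \<rho>" "\<rho> 0 = z" "\<rho> L \<in> K"
    "curve_cost H L \<rho> < hj_solution H K z + e"
    using hj_solution_less_obtain_curve[OF assms, of z "hj_solution H K z + e"] by auto
  let ?j = "join_curves (dist y z) (segment_curve y z) \<rho>"
  have L: "0 \<le> L" using \<rho>(1) by (simp add: unit_speed_curve_def)
  have seg: "unit_speed_curve (dist y z) (segment_curve y z)" "segment_curve y z (dist y z) = \<rho> 0"
    using \<rho>(2) by (simp_all add: unit_speed_segment_curve)
  have "?j 0 = y" "?j (dist y z + L) \<in> K"
    using \<rho>(2,3) L by (auto simp: join_curves_def)
  then have "hj_solution H K y \<le> curve_cost H (dist y z + L) ?j"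
    using hj_solution_le_curve_cost[OF unit_speed_curve_join[OF seg(1) \<rho>(1) seg(2)]] by metis
  also have "\<dots> \<le> dist y z / \<alpha>_lo + curve_cost H L \<rho>"
    using curve_cost_join[OF seg(1) \<rho>(1) seg(2)] curve_cost_bounds(2)[OF seg(1)] by simp
  finally show "hj_solution H K y \<le> hj_solution H K z + dist y z / \<alpha>_lo + e"
    using \<rho>(4) by simp
qed

text \<open>The remaining part of the curve is a competitor at \<open>\<rho> s\<close>, and the part already run costs at least \<open>s / \<alpha>_hi\<close>.\<close>

lemma hj_solution_decreases_along_curve:
  assumes "unit_speed_curve L \<rho>" "\<rho> L \<in> K" "s \<in> {0..L}"
  shows "hj_solution H K (\<rho> s) \<le> curve_cost H L \<rho> - s / \<alpha>_hi"
proof -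
  have s: "0 \<le> s" "s \<le> L" using assms(3) by auto
  have "hj_solution H K (\<rho> s) \<le> curve_cost H (L - s) (\<lambda>r. \<rho> (s + r))"
    using hj_solution_le_curve_cost[OF unit_speed_curve_tail[OF assms(1) s]] assms(2) by simp
  with curve_cost_split[OF assms(1) s] curve_cost_bounds(1)[OF unit_speed_curve_initial[OF assms(1) s]]
  show ?thesis by simp
qed

end

section \<open>John domains\<close>

text \<open>
  A bounded nonempty set has a nonempty frontier.  This matters because the distance to the empty set
  is zero by convention, so that the inequality fails for the whole space.
\<close>

lemma le_infdist_frontier:
  fixes U :: "'a::euclidean_space set"
  assumes "ball x r \<subseteq> U" "bounded U" "U \<noteq> {}"
  shows "r \<le> infdist x (frontier U)"
proof -
  have ne: "frontier U \<noteq> {}"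
    using assms(2,3) by (auto simp: frontier_eq_empty)
  have "r \<le> dist x y" if "y \<in> frontier U" for y
    using interior_maximal[OF assms(1) open_ball] that by (force simp: frontier_def)
  then show ?thesis
    using ne by (auto simp: infdist_def intro: cINF_greatest)
qed

lemma ball_infdist_frontier_subset:
  fixes U :: "'a::euclidean_space set"
  assumes "x \<in> U"
  shows "ball x (infdist x (frontier U)) \<subseteq> U"
proof
  fix y assume y: "y \<in> ball x (infdist x (frontier U))"
  show "y \<in> U"
  proof (rule ccontr)
    assume "y \<notin> U"
    moreover have "{x, y} \<subseteq> ball x (infdist x (frontier U))"
      using y by (auto intro: le_less_trans[OF zero_le_dist])
    ultimately obtain z where "z \<in> ball x (infdist x (frontier U))" "z \<in> frontier U"
      using connected_Int_frontier[OF connected_ball, of x "infdist x (frontier U)" U] assms by blast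
    then show False using infdist_le[of z "frontier U" x] by simp
  qed
qed

text \<open>
  For an interior point the distance to the frontier is itself an admissible radius, so the inradius
  at the point controls it.
\<close>

lemma infdist_frontier_le_Sup_balls:
  fixes K :: "'a::euclidean_space set"
  assumes "x0 \<in> interior K" "bounded K"
  shows "infdist x0 (frontier K) \<le> Sup {r. r > 0 \<and> ball x0 r \<subseteq> K}"
proof -
  let ?R = "{r. r > 0 \<and> ball x0 r \<subseteq> K}"
  have x0: "x0 \<in> K" using assms(1) interior_subset by blast
  have ne: "K \<noteq> {}" using x0 by blast
  have bdd: "bdd_above ?R"
    using le_infdist_frontier[OF _ assms(2) ne] by (intro bdd_aboveI[of _ "infdist x0 (frontier K)"]) blast
  obtain r where r: "r > 0" "ball x0 r \<subseteq> K" using assms(1) mem_interior by blast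
  then have "0 < infdist x0 (frontier K)"
    using le_infdist_frontier[OF r(2) assms(2) ne] by simp
  then show ?thesis
    using ball_infdist_frontier_subset[OF x0] by (intro cSup_upper bdd) blast
qed

text \<open>
  A connected set need not contain any rectifiable curve, so that its points are joined by
  polygons with short edges and vertices in the set.  Compactness bounds the lengths: only the
  polygons starting at finitely many points matter, up to one more short edge.
\<close>

lemma connected_compact_uniform_curves:
  fixes K :: "'a::euclidean_space set"
  assumes "compact K" "connected K" "x0 \<in> K" "0 < \<delta>"
  obtains M where "0 \<le> M" "\<And>y. y \<in> K \<Longrightarrow> \<exists>L \<gamma>. L \<le> M \<and> unit_speed_curve L \<gamma> \<and> \<gamma> 0 = y \<and> \<gamma> L = x0 \<and>
    \<gamma> ` {0..L} \<subseteq> (\<Union>z\<in>K. ball z \<delta>)"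
proof -
  define C where "C L y \<longleftrightarrow> (\<exists>\<gamma>. unit_speed_curve L \<gamma> \<and> \<gamma> 0 = y \<and> \<gamma> L = x0 \<and>
    \<gamma> ` {0..L} \<subseteq> (\<Union>z\<in>K. ball z \<delta>))" for L y
  have step: "C (dist y z + L) y" if C: "C L z" and "y \<in> K" "dist y z < \<delta>" for L y z
  proof -
    obtain \<gamma> where \<gamma>: "unit_speed_curve L \<gamma>" "\<gamma> 0 = z" "\<gamma> L = x0" "\<gamma> ` {0..L} \<subseteq> (\<Union>z\<in>K. ball z \<delta>)"
      using C unfolding C_def by blast
    let ?j = "join_curves (dist y z) (segment_curve y z) \<gamma>"
    have L: "0 \<le> L" using \<gamma>(1) by (simp add: unit_speed_curve_def)
    have "?j s \<in> (\<Union>z\<in>K. ball z \<delta>)" if s: "s \<in> {0..dist y z + L}" for s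
    proof (cases "s \<le> dist y z")
      case True
      then have "dist y (segment_curve y z s) = s"
        using s by (intro segment_curve_dist_start) auto
      then have "segment_curve y z s \<in> ball y \<delta>"
        using \<open>dist y z < \<delta>\<close> True by simp
      then show ?thesis using \<open>y \<in> K\<close> True by (auto simp: join_curves_def)
    next
      case False
      then have "\<gamma> (s - dist y z) \<in> (\<Union>z\<in>K. ball z \<delta>)"
        using s by (intro subsetD[OF \<gamma>(4)] imageI) auto
      then show ?thesis using False by (simp add: join_curves_def)
    qed
    moreover have "unit_speed_curve (dist y z + L) ?j"
      using \<gamma>(1,2) by (intro unit_speed_curve_join unit_speed_segment_curve) simp_all
    moreover have "?j 0 = y" "?j (dist y z + L) = x0"
      using \<gamma>(2,3) L by (auto simp: join_curves_def)
    ultimately show ?thesis unfolding C_def by blast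
  qed
  \<comment> \<open>In a connected set any two points are joined by a chain of points of the set with steps below \<open>\<delta>\<close>.\<close>
  let ?near = "\<lambda>y z. y \<in> K \<and> z \<in> K \<and> dist y z < \<delta>"
  have chain: "?near\<^sup>*\<^sup>* y x0" if "y \<in> K" for y
    using assms(2) that assms(3)
  proof (rule connected_equivalence_relation)
    show "?near\<^sup>*\<^sup>* z y" if "?near\<^sup>*\<^sup>* y z" for y z
    proof -
      have "symp ?near" by (auto simp: symp_def dist_commute)
      then show ?thesis using that by (blast dest: symp_rtranclp sympD)
    qed
    show "\<exists>T. openin (top_of_set K) T \<and> a \<in> T \<and> (\<forall>x\<in>T. ?near\<^sup>*\<^sup>* a x)" if "a \<in> K" for a
      using that assms(4) by (intro exI[of _ "K \<inter> ball a \<delta>"]) (auto intro!: r_into_rtranclp)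
  qed (rule rtranclp_trans)
  have x0: "C 0 x0"
    unfolding C_def using unit_speed_segment_curve[of x0 x0] assms(3,4)
    by (intro exI[of _ "segment_curve x0 x0"]) (auto intro!: bexI[of _ x0])
  have "\<exists>L. C L y" if "y \<in> K" for y
    using chain[OF that]
    by (induction rule: converse_rtranclp_induct) (use x0 step in blast)+
  then obtain l where l: "\<And>z. z \<in> K \<Longrightarrow> C (l z) z" by metis
  obtain F where F: "finite F" "F \<subseteq> K" "K \<subseteq> (\<Union>z\<in>F. ball z \<delta>)"
    using compactE_image[OF assms(1), of K "\<lambda>z. ball z \<delta>"] assms(4) by (metis UN_I centre_in_ball open_ball subsetI)
  have l0: "0 \<le> l z" if "z \<in> K" for z
    using l[OF that] by (auto simp: C_def unit_speed_curve_def)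
  show thesis
  proof (rule that)
    show "0 \<le> \<delta> + sum l F"
      using assms(4) F(2) l0 by (intro add_nonneg_nonneg sum_nonneg) auto
    fix y assume y: "y \<in> K"
    then obtain z where z: "z \<in> F" "dist y z < \<delta>"
      using F(3) by (auto simp: dist_commute)
    then have "C (dist y z + l z) y"
      using F(2) y by (intro step l) auto
    moreover have "l z \<le> sum l F"
      using z(1) F l0 by (intro member_le_sum) auto
    ultimately show "\<exists>L \<gamma>. L \<le> \<delta> + sum l F \<and> unit_speed_curve L \<gamma> \<and> \<gamma> 0 = y \<and> \<gamma> L = x0 \<and>
        \<gamma> ` {0..L} \<subseteq> (\<Union>z\<in>K. ball z \<delta>)"
      using z(2) unfolding C_def by (intro exI[of _ "dist y z + l z"]) auto
  qed
qed

section \<open>Sublevel sets of the solution\<close>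

locale hamilton_jacobi = elliptic_hamiltonian H \<alpha>_lo \<alpha>_hi
  for H :: "'a::euclidean_space \<Rightarrow> 'a \<Rightarrow> real" and \<alpha>_lo \<alpha>_hi :: real +
  fixes K :: "'a set"
  assumes K_nonempty: "K \<noteq> {}" and K_compact: "compact K"
begin

abbreviation reachable :: "real \<Rightarrow> 'a set" where
  "reachable t \<equiv> {x. hj_solution H K x < t}"

lemma target_subset_reachable: "0 < t \<Longrightarrow> K \<subseteq> reachable t"
  using hj_solution_nonpos_on_target by fastforce

text \<open>
  The margin \<open>\<alpha>_lo * t\<close> around \<open>K\<close> comes from the Lipschitz bound.  It adds up with the margin \<open>r\<close>
  inside \<open>K\<close> because a point of the larger ball is within \<open>\<alpha>_lo * t\<close> of the smaller one.
\<close>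

lemma ball_add_subset_reachable:
  assumes "y \<in> K" "ball y r \<subseteq> K" "0 < t"
  shows "ball y (r + \<alpha>_lo * t) \<subseteq> reachable t"
proof
  have near: "hj_solution H K w < t" if "z \<in> K" "dist z w < \<alpha>_lo * t" for z w
  proof -
    have "dist w z / \<alpha>_lo < t"
      using that(2) \<alpha>_lo_pos by (simp add: dist_commute pos_divide_less_eq mult.commute)
    then show ?thesis
      using hj_solution_lipschitz[OF K_nonempty, of w z] hj_solution_nonpos_on_target[OF that(1)] by simp
  qed
  fix w assume w: "w \<in> ball y (r + \<alpha>_lo * t)"
  consider "dist y w < r" | "dist y w < \<alpha>_lo * t" | "r \<le> dist y w" "\<alpha>_lo * t \<le> dist y w"
    by linarith
  then show "w \<in> reachable t"
  proof cases
    case 1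
    then show ?thesis using assms target_subset_reachable[OF assms(3)] by auto
  next
    case 2
    then show ?thesis using near assms(1) by simp
  next
    case 3
    \<comment> \<open>The point of the segment at distance \<open>d\<close> from \<open>y\<close> is in \<open>ball y r\<close> and closer
      than \<open>\<alpha>_lo * t\<close> to \<open>w\<close>: there is room for both since \<open>dist y w < r + \<alpha>_lo * t\<close>.\<close>
    define d where "d = (dist y w - \<alpha>_lo * t + r) / 2"
    let ?z = "segment_curve y w d"
    have "2 * d = dist y w - \<alpha>_lo * t + r" by (simp add: d_def)
    moreover have "dist y w < r + \<alpha>_lo * t" "0 < \<alpha>_lo * t"
      using w \<open>0 < t\<close> \<alpha>_lo_pos by simp_all
    ultimately have d: "d < r" "dist y w - d < \<alpha>_lo * t" "d \<le> dist y w" "0 \<le> d"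
      using 3 by linarith+
    have "?z \<in> K"
      using assms(2) d segment_curve_dist_start[of d y w] by auto
    moreover have "dist ?z w < \<alpha>_lo * t"
      using d segment_curve_dist_end[of d y w] by simp
    ultimately show ?thesis using near by simp
  qed
qed

lemma reachable_descent:
  assumes "x \<in> reachable t"
  obtains L \<rho> where "unit_speed_curve L \<rho>" "\<rho> 0 = x" "\<rho> L \<in> K" "L < \<alpha>_hi * t"
    "\<And>s. s \<in> {0..L} \<Longrightarrow> hj_solution H K (\<rho> s) < t - s / \<alpha>_hi"
proof -
  obtain L \<rho> where \<rho>: "unit_speed_curve L \<rho>" "\<rho> 0 = x" "\<rho> L \<in> K" "curve_cost H L \<rho> < t"
    using hj_solution_less_obtain_curve[OF K_nonempty] assms by blast
  have "L / \<alpha>_hi < t"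
    using curve_cost_bounds(1)[OF \<rho>(1)] \<rho>(4) by simp
  then have "L < \<alpha>_hi * t"
    using \<alpha>_hi_pos by (simp add: pos_divide_less_eq mult.commute)
  moreover have "hj_solution H K (\<rho> s) < t - s / \<alpha>_hi" if "s \<in> {0..L}" for s
    using hj_solution_decreases_along_curve[OF \<rho>(1,3) that] \<rho>(4) by simp
  ultimately show ?thesis using \<rho> that by blast
qed

lemma bounded_reachable: "bounded (reachable t)"
proof -
  obtain b where b: "\<And>y. y \<in> K \<Longrightarrow> norm y \<le> b"
    using compact_imp_bounded[OF K_compact] unfolding bounded_iff by blast
  have "norm x \<le> b + \<alpha>_hi * t" if x: "x \<in> reachable t" for x
  proof -
    obtain L \<rho> where \<rho>: "unit_speed_curve L \<rho>" "\<rho> 0 = x" "\<rho> L \<in> K" "L < \<alpha>_hi * t"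
      using reachable_descent[OF x] by blast
    have "dist x (\<rho> L) \<le> L"
      using unit_speed_curve_dist_le[OF \<rho>(1), of 0 L] \<rho>(1,2) by (simp add: unit_speed_curve_def)
    moreover have "norm x \<le> norm (\<rho> L) + dist x (\<rho> L)"
      by (metis dist_norm norm_triangle_sub)
    ultimately show ?thesis using b[OF \<rho>(3)] \<rho>(4) by simp
  qed
  then show ?thesis
    unfolding bounded_iff by blast
qed

text \<open>
  The John condition along the descent to \<open>K\<close> holds with \<open>\<alpha>_lo / \<alpha>_hi\<close>, the quotient of the speed at
  which \<open>u\<close> decreases and its Lipschitz constant.  For the curves that continue inside the sublevel set
  towards \<open>x0\<close>, the parameter is shifted by the length of the descent, of which only the bound
  \<open>\<alpha>_hi * t\<close> is known.
\<close>

lemma john_domain_wrt_reachableI: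
  assumes t: "0 < t" and \<kappa>: "0 < \<kappa>" "\<kappa> \<le> \<alpha>_lo / \<alpha>_hi" and x0: "x0 \<in> reachable t"
    and curves: "\<And>y. y \<in> K \<Longrightarrow> \<exists>M \<gamma>. unit_speed_curve M \<gamma> \<and> \<gamma> 0 = y \<and> \<gamma> M = x0 \<and>
      \<gamma> ` {0..M} \<subseteq> reachable t \<and>
      (\<forall>s\<in>{0..M}. \<kappa> * (\<alpha>_hi * t + s) \<le> infdist (\<gamma> s) (frontier (reachable t)))"
  shows "john_domain_wrt (reachable t) x0 \<kappa>"
proof -
  have joined: "\<exists>L \<rho>. unit_speed_curve L \<rho> \<and> \<rho> ` {0..L} \<subseteq> reachable t \<and> \<rho> 0 = x \<and> \<rho> L = x0 \<and>
      (\<forall>s\<in>{0..L}. \<kappa> * s \<le> infdist (\<rho> s) (frontier (reachable t)))" if x: "x \<in> reachable t" for x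
  proof -
    obtain L \<rho> where \<rho>: "unit_speed_curve L \<rho>" "\<rho> 0 = x" "\<rho> L \<in> K" "L < \<alpha>_hi * t" and
      dec: "\<And>s. s \<in> {0..L} \<Longrightarrow> hj_solution H K (\<rho> s) < t - s / \<alpha>_hi"
      using reachable_descent[OF x] by blast
    obtain M \<gamma> where \<gamma>: "unit_speed_curve M \<gamma>" "\<gamma> 0 = \<rho> L" "\<gamma> M = x0" "\<gamma> ` {0..M} \<subseteq> reachable t"
      and \<gamma>_far: "\<And>s. s \<in> {0..M} \<Longrightarrow> \<kappa> * (\<alpha>_hi * t + s) \<le> infdist (\<gamma> s) (frontier (reachable t))"
      using curves[OF \<rho>(3)] by blast
    let ?j = "join_curves L \<rho> \<gamma>"
    have LM: "0 \<le> L" "0 \<le> M" using \<rho>(1) \<gamma>(1) by (simp_all add: unit_speed_curve_def)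
    have on_\<rho>: "\<rho> s \<in> reachable t \<and> \<kappa> * s \<le> infdist (\<rho> s) (frontier (reachable t))"
      if s: "s \<in> {0..L}" for s
    proof
      have "0 \<le> s / \<alpha>_hi" using s \<alpha>_hi_pos by simp
      then show "\<rho> s \<in> reachable t" using dec[OF s] by simp
      have "ball (\<rho> s) (\<alpha>_lo / \<alpha>_hi * s) \<subseteq> reachable t"
      proof
        fix w assume "w \<in> ball (\<rho> s) (\<alpha>_lo / \<alpha>_hi * s)"
        then have "dist w (\<rho> s) / \<alpha>_lo < s / \<alpha>_hi"
          using \<alpha>_lo_pos by (simp add: dist_commute pos_divide_less_eq mult.commute)
        then show "w \<in> reachable t"
          using hj_solution_lipschitz[OF K_nonempty, of w "\<rho> s"] dec[OF s] by simp
      qed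
      then have "\<alpha>_lo / \<alpha>_hi * s \<le> infdist (\<rho> s) (frontier (reachable t))"
        using bounded_reachable x by (intro le_infdist_frontier) auto
      moreover have "\<kappa> * s \<le> \<alpha>_lo / \<alpha>_hi * s"
        using \<kappa>(2) s by (intro mult_right_mono) auto
      ultimately show "\<kappa> * s \<le> infdist (\<rho> s) (frontier (reachable t))" by simp
    qed
    have "?j s \<in> reachable t \<and> \<kappa> * s \<le> infdist (?j s) (frontier (reachable t))"
      if s: "s \<in> {0..L + M}" for s
    proof (cases "s \<le> L")
      case True
      then show ?thesis using on_\<rho>[of s] s by (simp add: join_curves_def)
    next
      case False
      have "\<kappa> * s \<le> \<kappa> * (\<alpha>_hi * t + (s - L))"
        using \<rho>(4) \<kappa>(1) by (intro mult_left_mono) auto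
      moreover have sL: "s - L \<in> {0..M}" using False s by auto
      have "\<gamma> (s - L) \<in> reachable t"
        using sL by (intro subsetD[OF \<gamma>(4)] imageI)
      ultimately show ?thesis
        using False \<gamma>_far[OF sL] by (simp add: join_curves_def)
    qed
    moreover have "unit_speed_curve (L + M) ?j" "?j 0 = x" "?j (L + M) = x0"
      using unit_speed_curve_join[OF \<rho>(1) \<gamma>(1)] \<rho>(2) \<gamma>(2,3) LM by (auto simp: join_curves_def)
    ultimately show ?thesis by blast
  qed
  have "\<alpha>_lo / \<alpha>_hi \<le> 1"
    using \<alpha>_hi_pos \<alpha>_le by simp
  with \<kappa>(2) have "\<kappa> \<le> 1" by simp
  moreover have "reachable t \<noteq> {}" using x0 by blast
  ultimately show ?thesis
    unfolding john_domain_wrt_def by (intro conjI ballI bounded_reachable x0 \<kappa>(1) joined)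
qed

lemma john_domain_reachable:
  assumes "connected K" and t: "0 < t"
  shows "john_domain (reachable t)"
proof -
  obtain x0 where x0: "x0 \<in> K" using K_nonempty by blast
  define \<delta> where "\<delta> = \<alpha>_lo * t / 2"
  have \<delta>: "0 < \<delta>" using t \<alpha>_lo_pos by (simp add: \<delta>_def)
  obtain M where M: "0 \<le> M" "\<And>y. y \<in> K \<Longrightarrow> \<exists>L \<gamma>. L \<le> M \<and> unit_speed_curve L \<gamma> \<and>
      \<gamma> 0 = y \<and> \<gamma> L = x0 \<and> \<gamma> ` {0..L} \<subseteq> (\<Union>z\<in>K. ball z \<delta>)"
    using connected_compact_uniform_curves[OF K_compact assms(1) x0 \<delta>] by blast
  have pos: "0 < \<alpha>_hi * t + M" using \<alpha>_hi_pos t M(1) by (simp add: add_pos_nonneg)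
  define \<kappa> where "\<kappa> = min (\<alpha>_lo / \<alpha>_hi) (\<delta> / (\<alpha>_hi * t + M))"
  have \<kappa>: "0 < \<kappa>" "\<kappa> \<le> \<alpha>_lo / \<alpha>_hi" "\<kappa> * (\<alpha>_hi * t + M) \<le> \<delta>"
  proof -
    show "0 < \<kappa>" using \<alpha>_lo_pos \<alpha>_hi_pos \<delta> pos by (simp add: \<kappa>_def)
    show "\<kappa> \<le> \<alpha>_lo / \<alpha>_hi" by (simp add: \<kappa>_def)
    have "\<kappa> \<le> \<delta> / (\<alpha>_hi * t + M)" by (simp add: \<kappa>_def)
    then show "\<kappa> * (\<alpha>_hi * t + M) \<le> \<delta>" using pos by (simp add: pos_le_divide_eq)
  qed
  have ball_sub: "ball z (\<alpha>_lo * t) \<subseteq> reachable t" if "z \<in> K" for z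
    using ball_add_subset_reachable[of z 0 t] that t by simp
  have x0': "x0 \<in> reachable t" using x0 target_subset_reachable[OF t] by blast
  have "john_domain_wrt (reachable t) x0 \<kappa>"
  proof (rule john_domain_wrt_reachableI[OF t \<kappa>(1,2) x0'])
    fix y assume "y \<in> K"
    then obtain L \<gamma> where \<gamma>: "L \<le> M" "unit_speed_curve L \<gamma>" "\<gamma> 0 = y" "\<gamma> L = x0"
      "\<gamma> ` {0..L} \<subseteq> (\<Union>z\<in>K. ball z \<delta>)"
      using M(2) by blast
    have "\<gamma> s \<in> reachable t \<and> \<kappa> * (\<alpha>_hi * t + s) \<le> infdist (\<gamma> s) (frontier (reachable t))"
      if s: "s \<in> {0..L}" for s
    proof
      obtain z where z: "z \<in> K" "dist z (\<gamma> s) < \<delta>" using subsetD[OF \<gamma>(5) imageI[OF s]] by auto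
      have "ball (\<gamma> s) \<delta> \<subseteq> ball z (\<alpha>_lo * t)"
        using z(2) by (auto simp: ball_subset_ball_iff \<delta>_def dist_commute)
      then have sub: "ball (\<gamma> s) \<delta> \<subseteq> reachable t" using ball_sub[OF z(1)] by blast
      then show "\<gamma> s \<in> reachable t" using centre_in_ball \<delta> by blast
      have "\<kappa> * (\<alpha>_hi * t + s) \<le> \<kappa> * (\<alpha>_hi * t + M)"
        using s \<gamma>(1) \<kappa>(1) by (intro mult_left_mono) auto
      also have "\<dots> \<le> \<delta>" by (rule \<kappa>(3))
      also have "\<delta> \<le> infdist (\<gamma> s) (frontier (reachable t))"
        using sub bounded_reachable x0' by (intro le_infdist_frontier) auto
      finally show "\<kappa> * (\<alpha>_hi * t + s) \<le> infdist (\<gamma> s) (frontier (reachable t))" .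
    qed
    with \<gamma>(2-4) show "\<exists>M \<gamma>. unit_speed_curve M \<gamma> \<and> \<gamma> 0 = y \<and> \<gamma> M = x0 \<and>
      \<gamma> ` {0..M} \<subseteq> reachable t \<and>
      (\<forall>s\<in>{0..M}. \<kappa> * (\<alpha>_hi * t + s) \<le> infdist (\<gamma> s) (frontier (reachable t)))"
      by (intro exI[of _ L] exI[of _ \<gamma>]) auto
  qed
  then show ?thesis unfolding john_domain_def by blast
qed

text \<open>
  The curves of the John domain \<open>K\<close> serve as the continuation of the descent; they keep the distance
  \<open>\<alpha>_lo * t + \<kappa>0 * s\<close> from the frontier of the sublevel set.  The range of \<open>s\<close> in the hypothesis
  \<open>bound\<close> reflects the John condition at the end point \<open>x0\<close>, which limits the length of such a curve.
\<close>

lemma john_domain_wrt_reachable: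
  assumes john: "john_domain_wrt K x0 \<kappa>0" and t: "0 < t"
    and \<kappa>: "0 < \<kappa>" "\<kappa> \<le> \<alpha>_lo / \<alpha>_hi"
    and bound: "\<And>s. \<lbrakk>0 \<le> s; \<kappa>0 * s \<le> infdist x0 (frontier K)\<rbrakk> \<Longrightarrow>
      \<kappa> * (\<alpha>_hi * t + s) \<le> \<alpha>_lo * t + \<kappa>0 * s"
  shows "john_domain_wrt (reachable t) x0 \<kappa>"
proof -
  have \<kappa>0: "0 < \<kappa>0" and x0: "x0 \<in> reachable t"
    using john target_subset_reachable[OF t] by (auto simp: john_domain_wrt_def)
  show ?thesis
  proof (rule john_domain_wrt_reachableI[OF t \<kappa> x0])
    fix y assume "y \<in> K"
    then obtain L \<gamma> where \<gamma>: "unit_speed_curve L \<gamma>" "\<gamma> ` {0..L} \<subseteq> K" "\<gamma> 0 = y" "\<gamma> L = x0"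
      and far: "\<And>s. s \<in> {0..L} \<Longrightarrow> \<kappa>0 * s \<le> infdist (\<gamma> s) (frontier K)"
      using john unfolding john_domain_wrt_def by blast
    have L: "0 \<le> L" using \<gamma>(1) by (simp add: unit_speed_curve_def)
    have "\<kappa> * (\<alpha>_hi * t + s) \<le> infdist (\<gamma> s) (frontier (reachable t))" if s: "s \<in> {0..L}" for s
    proof -
      have "\<kappa>0 * s \<le> \<kappa>0 * L" using s \<kappa>0 by simp
      also have "\<dots> \<le> infdist x0 (frontier K)" using far[of L] L \<gamma>(4) by simp
      finally have "\<kappa> * (\<alpha>_hi * t + s) \<le> \<alpha>_lo * t + \<kappa>0 * s"
        using s by (intro bound) auto
      also have "\<dots> \<le> infdist (\<gamma> s) (frontier (reachable t))"
      proof (rule le_infdist_frontier[OF _ bounded_reachable])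
        have K: "\<gamma> s \<in> K" using \<gamma>(2) s by blast
        have "ball (\<gamma> s) (\<kappa>0 * s) \<subseteq> K"
          using subset_ball[OF far[OF s]] ball_infdist_frontier_subset[OF K] by blast
        then show "ball (\<gamma> s) (\<alpha>_lo * t + \<kappa>0 * s) \<subseteq> reachable t"
          using ball_add_subset_reachable[OF K _ t, of "\<kappa>0 * s"] by (simp add: add.commute)
      qed (use x0 in blast)
      finally show ?thesis .
    qed
    with \<gamma>(1,3,4) subset_trans[OF \<gamma>(2) target_subset_reachable[OF t]]
    show "\<exists>M \<gamma>. unit_speed_curve M \<gamma> \<and> \<gamma> 0 = y \<and> \<gamma> M = x0 \<and>
      \<gamma> ` {0..M} \<subseteq> reachable t \<and>
      (\<forall>s\<in>{0..M}. \<kappa> * (\<alpha>_hi * t + s) \<le> infdist (\<gamma> s) (frontier (reachable t)))"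
      by (intro exI[of _ L] exI[of _ \<gamma>]) blast
  qed
qed

end

theorem theorem1p1:
  fixes H :: "real ^ 'n \<Rightarrow> real ^ 'n \<Rightarrow> real"
    and K :: "(real ^ 'n) set"
    and u :: "real ^ 'n \<Rightarrow> real"
    and \<alpha>_lo \<alpha>_hi :: real
  assumes closed_C: "closed (sublevel H)"
    and convex_C: "\<And>x. convex (sublevel_at H x)"
    and regular_C: "\<And>x. sublevel_at H x = closure {p. (x, p) \<in> interior (sublevel H)}"
    and alpha: "0 < \<alpha>_lo" "\<alpha>_lo \<le> \<alpha>_hi"
    and bounds_C: "\<And>x. ball 0 (1 / \<alpha>_hi) \<subseteq> sublevel_at H x \<and>
                        sublevel_at H x \<subseteq> ball 0 (1 / \<alpha>_lo)"
    and K: "K \<noteq> {}" "compact K" "connected K"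
    and u: "u = hj_solution H K"
  shows "(\<forall>t>0. john_domain {x. u x < t}) \<and>
         (\<forall>x0 \<kappa>0. x0 \<in> interior K \<and> john_domain_wrt K x0 \<kappa>0 \<longrightarrow>
            (\<forall>t>0. john_domain_wrt {x. u x < t} x0 (\<alpha>_lo / (2 * \<alpha>_hi + \<alpha>_lo) * \<kappa>0)) \<and>
            (\<forall>t. t > 2 * Sup {r. r > 0 \<and> ball x0 r \<subseteq> K} / (\<alpha>_lo * \<kappa>0) \<longrightarrow>
               john_domain_wrt {x. u x < t} x0 (\<alpha>_lo / (2 * \<alpha>_hi + \<alpha>_lo))))"
proof -
  interpret hamilton_jacobi H \<alpha>_lo \<alpha>_hi K
    using closed_C alpha bounds_C K(1,2) by unfold_locales auto
  have relative: "john_domain_wrt {x. u x < t} x0 (\<alpha>_lo / (2 * \<alpha>_hi + \<alpha>_lo) * \<kappa>0)"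
    if john: "john_domain_wrt K x0 \<kappa>0" and t: "0 < t" for x0 \<kappa>0 t
  proof -
    let ?q = "\<alpha>_lo / (2 * \<alpha>_hi + \<alpha>_lo)"
    have \<kappa>0: "0 < \<kappa>0" "\<kappa>0 \<le> 1" using john by (simp_all add: john_domain_wrt_def)
    have q: "0 < ?q" "?q \<le> 1" "?q \<le> \<alpha>_lo / \<alpha>_hi"
      using alpha by (auto intro!: frac_le)
    have "?q * \<kappa>0 \<le> ?q" using q(1) \<kappa>0 by (intro mult_left_le) simp_all
    moreover have "?q * \<kappa>0 \<le> \<kappa>0" using q \<kappa>0 by (intro mult_left_le_one_le) simp_all
    ultimately have le: "?q * \<kappa>0 \<le> \<alpha>_lo / \<alpha>_hi" "?q * \<kappa>0 \<le> \<kappa>0"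
      using q(3) by linarith+
    show ?thesis
      unfolding u
    proof (rule john_domain_wrt_reachable[OF john t _ le(1)])
      show "0 < ?q * \<kappa>0" using q(1) \<kappa>0(1) by (rule mult_pos_pos)
      fix s :: real assume s: "0 \<le> s"
      have "?q * \<kappa>0 * (\<alpha>_hi * t) \<le> \<alpha>_lo / \<alpha>_hi * (\<alpha>_hi * t)"
        using t \<alpha>_hi_pos by (intro mult_right_mono le) simp
      moreover have "\<alpha>_lo / \<alpha>_hi * (\<alpha>_hi * t) = \<alpha>_lo * t"
        using \<alpha>_hi_pos by simp
      moreover have "?q * \<kappa>0 * s \<le> \<kappa>0 * s"
        using s by (intro mult_right_mono le)
      ultimately show "?q * \<kappa>0 * (\<alpha>_hi * t + s) \<le> \<alpha>_lo * t + \<kappa>0 * s"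
        by (simp only: distrib_left)
    qed
  qed
  have absolute: "john_domain_wrt {x. u x < t} x0 (\<alpha>_lo / (2 * \<alpha>_hi + \<alpha>_lo))"
    if x0: "x0 \<in> interior K" and john: "john_domain_wrt K x0 \<kappa>0"
      and t: "t > 2 * Sup {r. r > 0 \<and> ball x0 r \<subseteq> K} / (\<alpha>_lo * \<kappa>0)" for x0 \<kappa>0 t
  proof -
    let ?q = "\<alpha>_lo / (2 * \<alpha>_hi + \<alpha>_lo)"
    let ?d = "infdist x0 (frontier K)"
    have \<kappa>0: "0 < \<kappa>0" using john by (simp add: john_domain_wrt_def)
    have "2 * ?d / (\<alpha>_lo * \<kappa>0) \<le> 2 * Sup {r. r > 0 \<and> ball x0 r \<subseteq> K} / (\<alpha>_lo * \<kappa>0)"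
      using infdist_frontier_le_Sup_balls[OF x0 compact_imp_bounded[OF K(2)]] alpha \<kappa>0
      by (intro divide_right_mono mult_left_mono) auto
    with t have td: "2 * ?d / (\<alpha>_lo * \<kappa>0) < t" by simp
    moreover have "0 \<le> 2 * ?d / (\<alpha>_lo * \<kappa>0)" using alpha \<kappa>0 by (simp add: infdist_nonneg)
    ultimately have t0: "0 < t" by simp
    have td: "2 * ?d < t * (\<alpha>_lo * \<kappa>0)"
      using td alpha \<kappa>0 by (simp add: pos_divide_less_eq)
    have q: "0 < ?q" "?q \<le> \<alpha>_lo / \<alpha>_hi"
      using alpha by (auto intro!: frac_le)
    show ?thesis
      unfolding u
    proof (rule john_domain_wrt_reachable[OF john t0 q])
      fix s :: real assume s: "0 \<le> s" "\<kappa>0 * s \<le> ?d"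
      \<comment> \<open>Hence \<open>s\<close> is at most \<open>\<alpha>_lo * t / 2\<close>, which is what the threshold on \<open>t\<close> is for.\<close>
      have "\<kappa>0 * (2 * s) \<le> \<kappa>0 * (\<alpha>_lo * t)" using s td by (simp add: algebra_simps)
      then have "2 * s \<le> \<alpha>_lo * t" using \<kappa>0 by simp
      moreover have "0 \<le> \<alpha>_hi * t" "0 \<le> \<alpha>_lo * t" using t0 alpha by simp_all
      ultimately have "\<alpha>_hi * t + s \<le> 2 * (\<alpha>_hi * t) + \<alpha>_lo * t" by linarith
      also have "\<dots> = (2 * \<alpha>_hi + \<alpha>_lo) * t" by (simp add: distrib_right)
      finally have "\<alpha>_hi * t + s \<le> (2 * \<alpha>_hi + \<alpha>_lo) * t" .
      then have "?q * (\<alpha>_hi * t + s) \<le> ?q * ((2 * \<alpha>_hi + \<alpha>_lo) * t)"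
        using q(1) by (intro mult_left_mono) auto
      also have "\<dots> = \<alpha>_lo * t" using alpha by simp
      also have "\<dots> \<le> \<alpha>_lo * t + \<kappa>0 * s" using \<kappa>0 s by simp
      finally show "?q * (\<alpha>_hi * t + s) \<le> \<alpha>_lo * t + \<kappa>0 * s" .
    qed
  qed
  show ?thesis
    using john_domain_reachable[OF K(3)] relative absolute unfolding u by blast
qed

end
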